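(* For every complex $q$ with $|q|<1$, $$\sum_{n,l,k=0}^\infty\frac{q^{n^2+l^2+k^2}\,(q;q)_{n+l+k}}{(q;q)_{n+l}(q;q)_{n+k}(q;q)_{l+k}(q;q)_n(q;q)_l(q;q)_k}=\frac{1}{(q;q)_\infty^2}\prod_{\substack{m\ge1\\ m\not\equiv0,\pm4\ (\mathrm{mod}\ 9)}}\frac{1}{1-q^m}.$$
   Context: Notation: $(x;q)_n=\prod_{j=0}^{n-1}(1-xq^j)$ for integers $n\ge0$, and $(x;q)_\infty=\prod_{j\ge0}(1-xq^j)$. *)

theory Defs
  imports "HOL-Analysis.Analysis" "HOL-Number_Theory.Cong"
begin

definition qpoch :: "complex \<Rightarrow> complex \<Rightarrow> nat \<Rightarrow> complex" where
  "qpoch x q n = (\<Prod>j<n. 1 - x * q ^ j)"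

definition qpoch_inf :: "complex \<Rightarrow> complex \<Rightarrow> complex" where
  "qpoch_inf x q = (\<Prod>j. 1 - x * q ^ j)"

end

theory Submission
  imports Defs
begin

text \<open>
  The q-analogue of Dixon's identity writes the quotient
  (q)_{n+l+k} / ((q)_{n+l} (q)_{n+k} (q)_{l+k} (q)_n (q)_l (q)_k) as the sum over all integers j of
  (-1)^j q^{j(3j+1)/2} times the product over m = n, l, k of 1 / ((q)_{m+j} (q)_{m-j}).
  This decouples the three summation variables, and by Cauchy's Durfee rectangle identity
  the sum over m of q^{m^2} / ((q)_{m+j} (q)_{m-j}) equals q^{j^2} / (q)_infinity.
  What is left is (q)_infinity^{-3} times the sum of (-1)^j q^{j(9j+1)/2}, which the Jacobi triple
  product evaluates.
\<close>

text \<open>The weights 1 / ((q)_{n+j} (q)_{n-j}) carry all three ingredients: the Dixon sum runs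
  over products of three of them, Cauchy's identity sums one over n, and a finite form of the triple
  product sums one over j. The two sums over j are treated alike, by a recurrence in n whose terms
  telescope in j. The weights are even in j, so j and -j can be folded together and q = 0 is no
  exception. The modulus 9 arises because Dixon contributes q^{3j^2/2} and the three decoupled sums
  q^{3j^2}; together with the linear term j/2 this fixes the parameters q^5 and q^4 of the triple
  product. That product cancels the residues 0, 4, 5 mod 9 in one of the three factors 1 /
  (q)_infinity. The exchange of summations rests on absolute summability: the weights are bounded
  uniformly, so the quadruple family is dominated by a product of four convergent series.\<close>

text \<open>This is (-1)^j z^j p^{j(j-1)/2}; the product form avoids halved exponents and grows by
  one factor at each step.\<close>

definition altprod :: "complex \<Rightarrow> complex \<Rightarrow> nat \<Rightarrow> complex" where
  "altprod z p j = (\<Prod>i<j. - z * p ^ i)"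

text \<open>
  The general term of Ramanujan's theta function, the sum over all integers j of
  (-1)^j x^{j(j+1)/2} y^{j(j-1)/2}, with the terms j and -j combined so that j ranges over
  the natural numbers and no negative powers occur.
\<close>

definition theta_coeff :: "complex \<Rightarrow> complex \<Rightarrow> nat \<Rightarrow> complex" where
  "theta_coeff x y j = (if j = 0 then 1 else altprod x (x * y) j + altprod y (x * y) j)"

text \<open>The weight of a Bailey pair relative to 1. The case distinction encodes 1 / (q)_m = 0
  for m < 0, where \<open>n - j\<close> would truncate to 0.\<close>

definition bailey_coeff :: "complex \<Rightarrow> nat \<Rightarrow> nat \<Rightarrow> complex" where
  "bailey_coeff q n j = (if j \<le> n then 1 / (qpoch q q (n + j) * qpoch q q (n - j)) else 0)"

lemma altprod_Suc [simp]: "altprod z p (Suc j) = altprod z p j * (- z * p ^ j)"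
  by (simp add: altprod_def)

lemma altprod_0 [simp]: "altprod z p 0 = 1"
  by (simp add: altprod_def)

lemma qpoch_0 [simp]: "qpoch x q 0 = 1"
  by (simp add: qpoch_def)

lemma qpoch_Suc: "qpoch x q (Suc n) = qpoch x q n * (1 - x * q ^ n)"
  by (simp add: qpoch_def)

lemma one_minus_power_nonzero:
  fixes q :: complex
  assumes "norm q < 1" "n > 0"
  shows "1 - q ^ n \<noteq> 0"
proof
  assume "1 - q ^ n = 0"
  then have "norm (q ^ n) = 1" by simp
  moreover have "norm q ^ n < 1" using assms by (simp add: power_less_one_iff)
  ultimately show False by (simp add: norm_power)
qed

lemma qpoch_nonzero:
  assumes "norm q < 1"
  shows "qpoch q q n \<noteq> 0"
  using one_minus_power_nonzero[OF assms, of "Suc _"] by (simp add: qpoch_def)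

section \<open>Contiguous relations for the weights, and the q-Dixon sum\<close>

lemma bailey_coeff_zero: "n < j \<Longrightarrow> bailey_coeff q n j = 0"
  by (simp add: bailey_coeff_def)

text \<open>Written without division, so that it holds for every j: for j > n the exponent
  \<open>Suc n - j\<close> truncates to 0 and its factor vanishes.\<close>

lemma bailey_coeff_raise:
  assumes "norm q < 1"
  shows "bailey_coeff q n j =
    (1 - q ^ (Suc n + j)) * (1 - q ^ (Suc n - j)) * bailey_coeff q (Suc n) j"
proof (cases "j \<le> n")
  case True
  have [simp]: "q * q ^ (n + j) \<noteq> 1" "q * q ^ (n - j) \<noteq> 1"
    using one_minus_power_nonzero[OF assms, of "Suc _"] by auto
  show ?thesis
    using True qpoch_nonzero[OF assms]
    by (simp add: bailey_coeff_def Suc_diff_le qpoch_Suc divide_simps)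
next
  case False
  then show ?thesis
    by (cases "j = Suc n") (auto simp: bailey_coeff_def)
qed

lemma bailey_coeff_shift:
  assumes "norm q < 1"
  shows "(1 - q ^ (n - j)) * bailey_coeff q n j =
    (1 - q ^ (n + Suc j)) * bailey_coeff q n (Suc j)"
proof (cases "j < n")
  case True
  then obtain d where n: "n = Suc (j + d)"
    using less_imp_Suc_add by blast
  have [simp]: "q * q ^ (n + j) \<noteq> 1" "q * q ^ d \<noteq> 1"
    using one_minus_power_nonzero[OF assms, of "Suc _"] by auto
  have "n - j = Suc d" "n - Suc j = d" using n by auto
  then show ?thesis
    using True qpoch_nonzero[OF assms]
    by (simp add: bailey_coeff_def qpoch_Suc divide_simps)
next
  case False
  then show ?thesis
    by (cases "j = n") (auto simp: bailey_coeff_def)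
qed

text \<open>
  The Wilf--Zeilberger certificate of Dixon's sum: the right-hand side vanishes at J = l.
\<close>

lemma dixon_partial_sum:
  fixes n l k :: nat
  assumes q: "norm q < 1"
  defines "N \<equiv> q ^ Suc n" and "L \<equiv> q ^ l" and "K \<equiv> q ^ k"
  shows "(\<Sum>j\<le>J. theta_coeff (q\<^sup>2) q j *
      ((1 - N * L) * (1 - N * K) * (1 - N) * bailey_coeff q (Suc n) j
        - (1 - N * L * K) * bailey_coeff q n j) * bailey_coeff q l j * bailey_coeff q k j) =
    N * q ^ (2 * J) * altprod q (q ^ 3) J *
      (1 - q ^ (Suc n - J)) * (1 - q ^ (l - J)) * (1 - q ^ (k - J)) *
      (bailey_coeff q (Suc n) J * bailey_coeff q l J * bailey_coeff q k J)"
proof (induction J)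
  case 0
  show ?case
    by (simp add: theta_coeff_def N_def L_def K_def bailey_coeff_raise[OF q, of n 0] algebra_simps)
next
  case (Suc J)
  let ?U = "bailey_coeff q (Suc n) (Suc J) * bailey_coeff q l (Suc J) * bailey_coeff q k (Suc J)"
  have coeff: "theta_coeff (q\<^sup>2) q (Suc J) = altprod q (q ^ 3) (Suc J) * (1 + q ^ Suc J)"
  proof -
    have "altprod (q\<^sup>2) (q ^ 3) j = altprod q (q ^ 3) j * q ^ j" for j
      by (induction j) (simp_all add: power2_eq_square mult_ac)
    moreover have "q\<^sup>2 * q = q ^ 3"
      by (simp add: power2_eq_square power3_eq_cube)
    ultimately show ?thesis
      by (simp add: theta_coeff_def distrib_left del: altprod_Suc power_Suc)
  qed
  \<comment> \<open>Shifting all three weights from J to \<open>Suc J\<close> makes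
    \<open>?U\<close> a common factor of the old boundary term, the new summand and the
    goal.\<close>
  have IH: "N * q ^ (2 * J) * altprod q (q ^ 3) J *
      (1 - q ^ (Suc n - J)) * (1 - q ^ (l - J)) * (1 - q ^ (k - J)) *
      (bailey_coeff q (Suc n) J * bailey_coeff q l J * bailey_coeff q k J) =
      N * q ^ (2 * J) * altprod q (q ^ 3) J *
      (1 - q ^ (Suc n + Suc J)) * (1 - q ^ (l + Suc J)) * (1 - q ^ (k + Suc J)) * ?U"
  proof -
    have "N * q ^ (2 * J) * altprod q (q ^ 3) J *
      (1 - q ^ (Suc n - J)) * (1 - q ^ (l - J)) * (1 - q ^ (k - J)) *
      (bailey_coeff q (Suc n) J * bailey_coeff q l J * bailey_coeff q k J) =
      N * q ^ (2 * J) * altprod q (q ^ 3) J *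
      ((1 - q ^ (Suc n - J)) * bailey_coeff q (Suc n) J) *
      ((1 - q ^ (l - J)) * bailey_coeff q l J) * ((1 - q ^ (k - J)) * bailey_coeff q k J)"
      by (simp only: mult_ac)
    also have "\<dots> = N * q ^ (2 * J) * altprod q (q ^ 3) J *
      ((1 - q ^ (Suc n + Suc J)) * bailey_coeff q (Suc n) (Suc J)) *
      ((1 - q ^ (l + Suc J)) * bailey_coeff q l (Suc J)) *
      ((1 - q ^ (k + Suc J)) * bailey_coeff q k (Suc J))"
      by (simp only: bailey_coeff_shift[OF q])
    finally show ?thesis by (simp only: mult_ac)
  qed
  show ?case
  \<comment> \<open>If \<open>?U\<close> vanishes, so does every term. Otherwise no subtraction
    truncates, all powers are monomials in q, X, A, B, C, and the claim becomes a polynomial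
    identity.\<close>
  proof (cases "?U = 0")
    case True
    then show ?thesis
      using Suc IH by (auto simp: bailey_coeff_raise[OF q, of n "Suc J"])
  next
    case False
    then have "Suc J \<le> Suc n" "Suc J \<le> l" "Suc J \<le> k"
      by (auto simp: bailey_coeff_def split: if_splits)
    then obtain a b c where abc: "Suc n = Suc J + a" "l = Suc J + b" "k = Suc J + c"
      by (auto simp: le_iff_add)
    define X A B C where "X = q ^ J" "A = q ^ a" "B = q ^ b" "C = q ^ c"
    note XABC = this
    have e: "N = X * q * A" "L = X * q * B" "K = X * q * C"
      unfolding N_def L_def K_def abc XABC by (simp_all add: power_add)
    have p1: "q ^ (Suc n + Suc J) = N * (X * q)" "q ^ (l + Suc J) = L * (X * q)"
       "q ^ (k + Suc J) = K * (X * q)" "q ^ Suc J = X * q"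
      unfolding N_def L_def K_def XABC power_add by simp_all
    have p2: "q ^ (Suc n - Suc J) = A" "q ^ (l - Suc J) = B" "q ^ (k - Suc J) = C"
      unfolding XABC abc by simp_all
    have p3: "q ^ (2 * J) = X ^ 2" "q ^ (2 * Suc J) = X ^ 2 * q ^ 2" "(q ^ 3) ^ J = X ^ 3"
      unfolding XABC by (simp_all add: power2_eq_square mult_ac flip: power_mult power_add mult_2)
    \<comment> \<open>The claim with the common factors \<open>altprod q (q ^ 3) J\<close> and
      \<open>?U\<close> removed; \<open>- q * X ^ 3\<close> is the factor that
      \<open>altprod\<close> gains from J to \<open>Suc J\<close>.\<close>
    have id: "- q * X ^ 3 * (1 + X * q) * ((1 - N * L) * (1 - N * K) * (1 - N)
        - (1 - N * L * K) * ((1 - N * (X * q)) * (1 - A)))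
        + N * X ^ 2 * (1 - N * (X * q)) * (1 - L * (X * q)) * (1 - K * (X * q))
      = N * (X ^ 2 * q ^ 2) * (- q * X ^ 3) * (1 - A) * (1 - B) * (1 - C)"
      unfolding e by algebra
    have factor_out: "b * w * (u * v * t) + w * a * (D * u - E * (r * u)) * v * t = c * w * (u * v * t)"
      if "a * (D - E * r) + b = c" for a b c w u v t D E r :: complex
      unfolding that[symmetric] by (simp add: algebra_simps)
    show ?thesis
      unfolding sum.atMost_Suc Suc.IH IH
      unfolding coeff bailey_coeff_raise[OF q, of n "Suc J"]
        altprod_Suc p1 p2 p3
      using factor_out[OF id, of "altprod q (q ^ 3) J" "bailey_coeff q (Suc n) (Suc J)"
          "bailey_coeff q l (Suc J)" "bailey_coeff q k (Suc J)"]
      by (simp only: mult_ac)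
  qed
qed

text \<open>Induction on n: both sides obey the same first-order recurrence in n. The range
  \<open>j \<le> l\<close> contains every nonzero term and stays fixed while n grows.\<close>

lemma q_dixon:
  assumes q: "norm q < 1"
  shows "(\<Sum>j\<le>l. theta_coeff (q\<^sup>2) q j *
      bailey_coeff q n j * bailey_coeff q l j * bailey_coeff q k j) =
    qpoch q q (n + l + k) /
      (qpoch q q (n + l) * qpoch q q (n + k) * qpoch q q (l + k) *
       qpoch q q n * qpoch q q l * qpoch q q k)"
proof (induction n)
  case 0
  have "(\<Sum>j\<le>l. theta_coeff (q\<^sup>2) q j *
      bailey_coeff q 0 j * bailey_coeff q l j * bailey_coeff q k j) =
    (\<Sum>j\<in>{0}. theta_coeff (q\<^sup>2) q j *
      bailey_coeff q 0 j * bailey_coeff q l j * bailey_coeff q k j)"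
    by (intro sum.mono_neutral_right) (auto simp: bailey_coeff_def)
  also have "\<dots> = qpoch q q (l + k) / (qpoch q q l * qpoch q q k * qpoch q q (l + k)
      * qpoch q q l * qpoch q q k)"
    using qpoch_nonzero[OF q] by (simp add: bailey_coeff_def theta_coeff_def divide_simps)
  finally show ?case by simp
next
  case (Suc n)
  define N L K where "N = q ^ Suc n" "L = q ^ l" "K = q ^ k"
  let ?S = "\<lambda>n. \<Sum>j\<le>l. theta_coeff (q\<^sup>2) q j *
      bailey_coeff q n j * bailey_coeff q l j * bailey_coeff q k j"
  have "(1 - N * L) * (1 - N * K) * (1 - N) * ?S (Suc n) - (1 - N * L * K) * ?S n = 0"
    using dixon_partial_sum[OF q, of n l k l]
    unfolding sum_distrib_left sum_subtractf[symmetric] N_L_K_def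
    by (simp add: left_diff_distrib right_diff_distrib mult.assoc mult.left_commute)
  moreover have nz: "1 - N * L \<noteq> 0" "1 - N * K \<noteq> 0" "1 - N \<noteq> 0"
    unfolding N_L_K_def power_add[symmetric]
    by (rule one_minus_power_nonzero[OF q], simp)+
  ultimately have "?S (Suc n) = (1 - N * L * K) * ?S n / ((1 - N * L) * (1 - N * K) * (1 - N))"
    by (simp add: nonzero_eq_divide_eq mult.commute del: mult_eq_0_iff)
  also have "\<dots> = qpoch q q (Suc n + l + k) /
      (qpoch q q (Suc n + l) * qpoch q q (Suc n + k) * qpoch q q (l + k) *
       qpoch q q (Suc n) * qpoch q q l * qpoch q q k)"
  proof -
    have "qpoch q q (Suc n + l + k) = qpoch q q (n + l + k) * (1 - N * L * K)"
      "qpoch q q (Suc n + l) = qpoch q q (n + l) * (1 - N * L)"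
      "qpoch q q (Suc n + k) = qpoch q q (n + k) * (1 - N * K)"
      "qpoch q q (Suc n) = qpoch q q n * (1 - N)"
      by (simp_all add: qpoch_Suc N_L_K_def power_add mult_ac)
    then show ?thesis
      unfolding Suc.IH by (simp add: mult_ac)
  qed
  finally show ?case .
qed

section \<open>Infinite q-products, uniform bounds and summability\<close>

lemma convergent_prod_qpoch:
  assumes "norm q < 1"
  shows "convergent_prod (\<lambda>j. 1 - x * q ^ j :: complex)"
proof -
  have "summable (\<lambda>j. norm (- x * q ^ j))"
    using assms by (auto simp: norm_mult norm_power intro!: summable_mult summable_geometric)
  then show ?thesis
    by (intro abs_convergent_prod_imp_convergent_prod)
       (simp add: abs_convergent_prod_conv_summable norm_minus_commute)
qed

lemma qpoch_tendsto:
  assumes "norm q < 1"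
  shows "qpoch x q \<longlonglongrightarrow> qpoch_inf x q"
  using has_prod_imp_tendsto'[OF convergent_prod_has_prod[OF convergent_prod_qpoch[OF assms]]]
  by (simp add: qpoch_def[abs_def] qpoch_inf_def)

lemma qpoch_inf_nonzero:
  assumes "norm q < 1"
  shows "qpoch_inf q q \<noteq> 0"
proof -
  have "1 - q * q ^ j \<noteq> 0" for j
    using one_minus_power_nonzero[OF assms, of "Suc j"] by simp
  then show ?thesis
    unfolding qpoch_inf_def using convergent_prod_qpoch[OF assms] by (intro prodinf_nonzero)
qed

lemma inverse_qpoch_bounded:
  assumes "norm q < 1"
  obtains C where "C > 0" "\<And>n. norm (1 / qpoch q q n) \<le> C"
proof -
  have "(\<lambda>n. 1 / qpoch q q n) \<longlonglongrightarrow> 1 / qpoch_inf q q"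
    by (intro tendsto_intros qpoch_tendsto assms qpoch_inf_nonzero)
  then have "Bseq (\<lambda>n. 1 / qpoch q q n)"
    by (intro convergent_imp_Bseq convergentI)
  with that show ?thesis by (auto simp: Bseq_def)
qed

text \<open>Uniformity in both indices is the point: the bound is the majorant for the limit in the
  triple product and for the quadruple family.\<close>

lemma bailey_coeff_bounded:
  assumes "norm q < 1"
  obtains C where "C > 0" "\<And>n j. norm (bailey_coeff q n j) \<le> C"
proof -
  obtain B where B: "B > 0" "\<And>n. norm (1 / qpoch q q n) \<le> B"
    using inverse_qpoch_bounded[OF assms] by blast
  have "norm (bailey_coeff q n j) \<le> B * B" for n j
  proof (cases "j \<le> n")
    case True
    then have "norm (bailey_coeff q n j) =
        norm (1 / qpoch q q (n + j)) * norm (1 / qpoch q q (n - j))"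
      by (simp add: bailey_coeff_def norm_divide norm_mult)
    also have "\<dots> \<le> B * B"
      using B by (intro mult_mono) auto
    finally show ?thesis .
  qed (use B in \<open>simp add: bailey_coeff_def\<close>)
  with B(1) that show ?thesis by (meson mult_pos_pos)
qed

lemma summable_on_power_square:
  fixes r :: real
  assumes "0 \<le> r" "r < 1"
  shows "(\<lambda>n::nat. r ^ n\<^sup>2) summable_on UNIV"
proof -
  have "summable (\<lambda>n::nat. r ^ n\<^sup>2)"
  proof (rule summable_comparison_test'[where N = 0])
    show "summable (\<lambda>n. r ^ n)" using assms by (simp add: summable_geometric)
    show "norm (r ^ n\<^sup>2) \<le> r ^ n" for n
      using assms by (auto simp: power2_eq_square intro!: power_decreasing)
  qed
  then show ?thesis using assms by (intro summable_nonneg_imp_summable_on) auto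
qed

lemma norm_altprod_le:
  assumes "norm p \<le> 1"
  shows "norm (altprod z p j) \<le> norm z ^ j"
proof (induction j)
  case (Suc j)
  have "norm (altprod z p (Suc j)) = norm (altprod z p j) * (norm z * norm p ^ j)"
    by (simp add: norm_mult norm_power)
  also have "\<dots> \<le> norm z ^ j * (norm z * 1)"
    using assms Suc by (intro mult_mono) (auto simp: power_le_one)
  finally show ?case by (simp add: mult.commute)
qed simp

lemma theta_coeff_summable:
  assumes "norm x < 1" "norm y < 1"
  shows "summable (\<lambda>j. norm (theta_coeff x y j))"
proof (rule summable_comparison_test'[where N = 0])
  show "summable (\<lambda>j. norm x ^ j + norm y ^ j)"
    using assms by (intro summable_add) (auto simp: summable_geometric)
  have "norm (x * y) \<le> 1"
    using assms mult_mono[of "norm x" 1 "norm y" 1] by (simp add: norm_mult)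
  then show "norm (norm (theta_coeff x y j)) \<le> norm x ^ j + norm y ^ j" for j
    by (auto simp: theta_coeff_def intro!: order.trans[OF norm_triangle_ineq] add_mono norm_altprod_le)
qed

subsection \<open>Cauchy's Durfee rectangle identity\<close>

text \<open>The generating function of the partitions whose largest rectangle of shape m by m + a
  has this m: the power of q is the rectangle, the two denominators are the partitions beside and
  below it.\<close>

definition durfee_term :: "complex \<Rightarrow> nat \<Rightarrow> nat \<Rightarrow> complex" where
  "durfee_term q a m = q ^ (m\<^sup>2 + a * m) / (qpoch q q m * qpoch q q (m + a))"

text \<open>Lowering m^2 to m gives a geometric majorant; keeping a * m leaves a factor |q|^a for
  every m > 0, which the limit in a needs.\<close>

lemma norm_durfee_term_le:
  assumes "norm q < 1" and B: "B > 0" "\<And>n. norm (1 / qpoch q q n) \<le> B"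
  shows "norm (durfee_term q a m) \<le> B\<^sup>2 * norm q ^ (m + a * m)"
proof -
  have "norm (durfee_term q a m) =
      norm q ^ (m\<^sup>2 + a * m) * (norm (1 / qpoch q q m) * norm (1 / qpoch q q (m + a)))"
    by (simp add: durfee_term_def norm_divide norm_mult norm_power)
  also have "\<dots> \<le> norm q ^ (m + a * m) * (B * B)"
    using B assms(1) by (intro mult_mono power_decreasing) (auto simp: power2_eq_square)
  finally show ?thesis by (simp add: power2_eq_square mult.commute)
qed

lemma durfee_term_summable:
  assumes "norm q < 1"
  shows "summable (\<lambda>m. norm (durfee_term q a m))"
proof -
  obtain B where B: "B > 0" "\<And>n. norm (1 / qpoch q q n) \<le> B"
    using inverse_qpoch_bounded[OF assms] by blast
  show ?thesis
  proof (rule summable_comparison_test'[where N = 0])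
    show "summable (\<lambda>m. B\<^sup>2 * norm q ^ m)"
      using assms by (intro summable_mult) (simp add: summable_geometric)
    have "B\<^sup>2 * norm q ^ (m + a * m) \<le> B\<^sup>2 * norm q ^ m" for m
      using assms by (intro mult_left_mono power_decreasing) auto
    then show "norm (norm (durfee_term q a m)) \<le> B\<^sup>2 * norm q ^ m" for m
      using norm_durfee_term_le[OF assms B, of a m] by (simp add: order_trans)
  qed
qed

text \<open>The term m = 0 is \<open>1 / qpoch q q a\<close>, and all later terms together are
  O(|q|^a).\<close>

lemma durfee_tendsto:
  assumes q: "norm q < 1"
  shows "(\<lambda>a. \<Sum>m. durfee_term q a m) \<longlonglongrightarrow> 1 / qpoch_inf q q"
proof -
  obtain B where B: "B > 0" "\<And>n. norm (1 / qpoch q q n) \<le> B"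
    using inverse_qpoch_bounded[OF q] by blast
  define T where "T = (\<Sum>m. B\<^sup>2 * norm q ^ m)"
  have tail: "norm ((\<Sum>m. durfee_term q a m) - 1 / qpoch q q a) \<le> T * norm q ^ a" for a
  proof -
    have "(\<Sum>m. durfee_term q a m) - 1 / qpoch q q a = (\<Sum>m. durfee_term q a (Suc m))"
      using suminf_split_head[OF summable_norm_cancel[OF durfee_term_summable[OF q, of a]]]
      by (simp add: durfee_term_def)
    also have "norm \<dots> \<le> (\<Sum>m. B\<^sup>2 * norm q ^ m * norm q ^ a)"
    proof (rule norm_suminf_le)
      fix m
      have "norm (durfee_term q a (Suc m)) \<le> B\<^sup>2 * norm q ^ (Suc m + a * Suc m)"
        by (rule norm_durfee_term_le[OF q B])
      also have "\<dots> \<le> B\<^sup>2 * norm q ^ (m + a)"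
        using q by (intro mult_left_mono power_decreasing) auto
      finally show "norm (durfee_term q a (Suc m)) \<le> B\<^sup>2 * norm q ^ m * norm q ^ a"
        by (simp add: power_add mult.assoc)
      show "summable (\<lambda>m. B\<^sup>2 * norm q ^ m * norm q ^ a)"
        using q by (intro summable_mult summable_mult2) (simp add: summable_geometric)
    qed
    also have "\<dots> = T * norm q ^ a"
      unfolding T_def using q
      by (intro suminf_mult2[symmetric] summable_mult) (simp add: summable_geometric)
    finally show ?thesis .
  qed
  have "(\<lambda>a. T * norm q ^ a) \<longlonglongrightarrow> 0"
    using q by (intro tendsto_mult_right_zero LIMSEQ_power_zero) simp
  then have "(\<lambda>a. (\<Sum>m. durfee_term q a m) - 1 / qpoch q q a) \<longlonglongrightarrow> 0"
    by (rule Lim_null_comparison[rotated]) (simp add: tail)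
  moreover have "(\<lambda>a. 1 / qpoch q q a) \<longlonglongrightarrow> 1 / qpoch_inf q q"
    by (intro tendsto_intros qpoch_tendsto q qpoch_inf_nonzero)
  ultimately show ?thesis
    using tendsto_add by fastforce
qed

text \<open>Over the denominator (q)_m (q)_{m+a+1} the difference of two terms has the numerator
  q^{m^2+am} times (1 - q^m) - q^m q^{a+1}. The first part, \<open>g\<close>, vanishes at m = 0, and
  its factor 1 - q^m cancels against (q)_m, so a shift of m turns it into a term with parameter a +
  2.\<close>

lemma durfee_recurrence:
  assumes q: "norm q < 1"
  shows "(\<Sum>m. durfee_term q a m) - (\<Sum>m. durfee_term q (Suc a) m) =
    - (q ^ Suc a) * ((\<Sum>m. durfee_term q (Suc a) m) - (\<Sum>m. durfee_term q (Suc (Suc a)) m))"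
proof -
  note nz = qpoch_nonzero[OF q]
  note sm = summable_norm_cancel[OF durfee_term_summable[OF q]]
  define g where "g m = q ^ (m\<^sup>2 + a * m) * (1 - q ^ m) / (qpoch q q m * qpoch q q (m + Suc a))" for m
  have g_Suc: "g (Suc m) = q ^ Suc a * durfee_term q (Suc (Suc a)) m" for m
  proof -
    have "1 - q * q ^ m \<noteq> 0" using one_minus_power_nonzero[OF q, of "Suc m"] by simp
    moreover have "(Suc m)\<^sup>2 + a * Suc m = Suc a + (m\<^sup>2 + Suc (Suc a) * m)"
      by (simp add: power2_eq_square)
    ultimately show ?thesis
      unfolding g_def durfee_term_def using nz by (simp add: qpoch_Suc power_add mult_ac)
  qed
  have split: "durfee_term q a m - durfee_term q (Suc a) m = g m - q ^ Suc a * durfee_term q (Suc a) m" for m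
  proof -
    have "1 - q ^ Suc (m + a) \<noteq> 0" using one_minus_power_nonzero[OF q, of "Suc (m + a)"] by simp
    then have "durfee_term q a m =
        q ^ (m\<^sup>2 + a * m) * (1 - q ^ Suc (m + a)) / (qpoch q q m * qpoch q q (m + Suc a))"
      using nz by (simp add: durfee_term_def qpoch_Suc)
    moreover have "durfee_term q (Suc a) m = 
        q ^ (m\<^sup>2 + a * m) * q ^ m / (qpoch q q m * qpoch q q (m + Suc a))"
      by (simp add: durfee_term_def power_add mult_ac)
    moreover have "q ^ Suc (m + a) = q ^ m * q ^ Suc a" by (simp add: power_add)
    ultimately show ?thesis
      by (simp add: g_def diff_divide_distrib[symmetric] del: power_Suc) (simp add: algebra_simps)
  qed
  have gs: "summable g"
    using summable_mult[OF sm, of "q ^ Suc a" "Suc (Suc a)"] by (subst summable_Suc_iff[symmetric]) (simp only: g_Suc)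
  have "g 0 = 0" by (simp add: g_def)
  then have "(\<Sum>m. g m) = q ^ Suc a * (\<Sum>m. durfee_term q (Suc (Suc a)) m)"
    using suminf_split_head[OF gs] suminf_mult[OF sm, of "q ^ Suc a" "Suc (Suc a)"]
    by (simp only: g_Suc) simp
  moreover have "(\<Sum>m. durfee_term q a m) - (\<Sum>m. durfee_term q (Suc a) m) =
      (\<Sum>m. g m) - q ^ Suc a * (\<Sum>m. durfee_term q (Suc a) m)"
    using suminf_diff[OF sm sm, of a "Suc a"] suminf_diff[OF gs summable_mult[OF sm, of "q ^ Suc a" "Suc a"]]
      suminf_mult[OF sm, of "q ^ Suc a" "Suc a"]
    by (simp only: split)
  ultimately show ?thesis by (simp add: algebra_simps)
qed

text \<open>
  By the recurrence the consecutive differences do not decrease in norm, yet they tend to 0;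
  hence the sum does not depend on a, and its value is the limit for large a.
\<close>

lemma durfee_suminf:
  assumes q: "norm q < 1"
  shows "(\<Sum>m. durfee_term q a m) = 1 / qpoch_inf q q"
proof -
  define F where "F a = (\<Sum>m. durfee_term q a m)" for a
  have lim: "F \<longlonglongrightarrow> 1 / qpoch_inf q q"
    unfolding F_def by (rule durfee_tendsto[OF q])
  have le: "norm (F a - F (Suc a)) \<le> norm (F (a + b) - F (Suc (a + b)))" for a b
  proof (induction b)
    case (Suc b)
    have "norm (F (a + b) - F (Suc (a + b))) =
        norm q ^ Suc (a + b) * norm (F (a + Suc b) - F (Suc (a + Suc b)))"
      using durfee_recurrence[OF q, of "a + b"]
      by (simp add: F_def norm_mult norm_power del: power_Suc)
    also have "\<dots> \<le> 1 * norm (F (a + Suc b) - F (Suc (a + Suc b)))"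
      using q by (intro mult_right_mono power_le_one) auto
    finally show ?case using Suc by simp
  qed simp
  have const: "F (Suc a) = F a" for a
  proof -
    have "(\<lambda>b. norm (F (b + a) - F (b + Suc a))) \<longlonglongrightarrow> norm (1 / qpoch_inf q q - 1 / qpoch_inf q q)"
      by (intro tendsto_norm tendsto_diff LIMSEQ_ignore_initial_segment lim)
    then have "norm (F a - F (Suc a)) \<le> norm (1 / qpoch_inf q q - 1 / qpoch_inf q q)"
      by (rule LIMSEQ_le_const) (use le[of a] in \<open>auto simp: add.commute\<close>)
    then show ?thesis by simp
  qed
  have "F (b + a) = F a" for b
    by (induction b) (simp_all add: const)
  with LIMSEQ_ignore_initial_segment[OF lim, of a] have "(\<lambda>_. F a) \<longlonglongrightarrow> 1 / qpoch_inf q q"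
    by simp
  then have "F a = 1 / qpoch_inf q q"
    by (rule LIMSEQ_unique[OF tendsto_const])
  then show ?thesis by (simp add: F_def)
qed

text \<open>For n = m + j one has n^2 = j^2 + m^2 + 2jm, n + j = m + 2j and n - j = m: this is
  q^{j^2} times the Durfee sum with a = 2j.\<close>

lemma bailey_coeff_has_sum:
  assumes q: "norm q < 1"
  shows "((\<lambda>n. q ^ n\<^sup>2 * bailey_coeff q n j) has_sum (q ^ j\<^sup>2 / qpoch_inf q q)) UNIV"
proof -
  have "(durfee_term q (2 * j) has_sum (1 / qpoch_inf q q)) UNIV"
    using norm_summable_imp_has_sum[OF durfee_term_summable[OF q] summable_sums]
      summable_norm_cancel[OF durfee_term_summable[OF q]] durfee_suminf[OF q] by metis
  then have "((\<lambda>m. q ^ j\<^sup>2 * durfee_term q (2 * j) m) has_sum (q ^ j\<^sup>2 * (1 / qpoch_inf q q))) UNIV"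
    by (rule has_sum_cmult_right)
  moreover have "q ^ j\<^sup>2 * durfee_term q (2 * j) m = q ^ (m + j)\<^sup>2 * bailey_coeff q (m + j) j" for m
  proof -
    have "(m + j)\<^sup>2 = j\<^sup>2 + (m\<^sup>2 + 2 * j * m)" by (simp add: power2_eq_square algebra_simps)
    moreover have "m + j + j = m + 2 * j" by simp
    ultimately show ?thesis
      by (simp only: durfee_term_def bailey_coeff_def power_add) simp
  qed
  ultimately have "((\<lambda>n. q ^ n\<^sup>2 * bailey_coeff q n j) has_sum (q ^ j\<^sup>2 / qpoch_inf q q)) {j..}"
    by (subst has_sum_reindex_bij_witness[where i = "\<lambda>m. m + j" and j = "\<lambda>n. n - j" and T = UNIV
        and h = "\<lambda>m. q ^ j\<^sup>2 * durfee_term q (2 * j) m"]) auto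
  then show ?thesis
    by (rule has_sum_cong_neutral[THEN iffD1, rotated -1]) (auto simp: bailey_coeff_def)
qed

subsection \<open>The Jacobi triple product\<close>

text \<open>Multiplied by (p)_{2n}, \<open>bailey_coeff p n j\<close> is the Gaussian binomial 2n
  over n + j; the relation is the q-Pascal rule applied twice, from row 2n to row 2n + 2.\<close>

lemma bailey_coeff_index_recurrence:
  assumes p: "norm p < 1"
  shows "(1 - p ^ (2 * n + 1)) * (1 - p ^ (2 * n + 2)) * bailey_coeff p (Suc n) (Suc j) =
    (1 + p ^ (2 * n + 1)) * bailey_coeff p n (Suc j) + p ^ (n - j) * bailey_coeff p n j
      + p ^ (n + j + 2) * bailey_coeff p n (Suc (Suc j))"
proof -
  define U where "U = bailey_coeff p (Suc n) (Suc j)"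
  have B1: "bailey_coeff p n (Suc j) = (1 - p ^ (n + j + 2)) * (1 - p ^ (n - j)) * U"
    using bailey_coeff_raise[OF p, of n "Suc j"] by (simp add: U_def)
  have B0: "bailey_coeff p n j = (1 - p ^ (n + j + 1)) * (1 - p ^ (n + j + 2)) * U"
    using bailey_coeff_raise[OF p, of n j] bailey_coeff_shift[OF p, of "Suc n" j]
    by (simp add: U_def)
  have B2: "bailey_coeff p n (Suc (Suc j)) = (1 - p ^ (n - Suc j)) * (1 - p ^ (n - j)) * U"
    using bailey_coeff_raise[OF p, of n "Suc (Suc j)"] bailey_coeff_shift[OF p, of "Suc n" "Suc j"]
    by (simp add: U_def)
  \<comment> \<open>The case j = n stands apart because \<open>n - Suc j\<close> truncates
    there.\<close>
  consider "U = 0" | "j = n" | d where "n = Suc (j + d)"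
    by (metis Suc_le_mono U_def bailey_coeff_zero le_neq_implies_less less_imp_Suc_add not_less)
  then show ?thesis
  proof cases
    case 1
    then show ?thesis by (simp add: B0 B1 B2 flip: U_def)
  next
    case 2
    then show ?thesis unfolding B0 B1 B2 U_def[symmetric] by (simp add: mult_2)
  next
    case 3
    define u v where "u = p ^ j" "v = p ^ d"
    have e: "p ^ (2 * n + 1) = u ^ 2 * v ^ 2 * p ^ 3" "p ^ (2 * n + 2) = u ^ 2 * v ^ 2 * p ^ 4"
      "p ^ (n - j) = p * v" "p ^ (n - Suc j) = v" "p ^ (n + j + 1) = u ^ 2 * v * p ^ 2"
      "p ^ (n + j + 2) = u ^ 2 * v * p ^ 3"
      unfolding 3 u_v_def by (simp_all add: eval_nat_numeral power_add mult_ac)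
    show ?thesis
      unfolding B0 B1 B2 U_def[symmetric] e by algebra
  qed
qed

text \<open>The preceding recurrence continued to j = -1: the weights are even, so both neighbours
  of 0 contribute the same, hence the 2.\<close>

lemma bailey_coeff_index_recurrence_0:
  assumes p: "norm p < 1"
  shows "(1 - p ^ (2 * n + 1)) * (1 - p ^ (2 * n + 2)) * bailey_coeff p (Suc n) 0 =
    (1 + p ^ (2 * n + 1)) * bailey_coeff p n 0 + 2 * p ^ Suc n * bailey_coeff p n (Suc 0)"
proof -
  define U where "U = bailey_coeff p (Suc n) 0"
  have "bailey_coeff p n (Suc 0) = (1 - p ^ n) * ((1 - p ^ (n + 2)) * bailey_coeff p (Suc n) (Suc 0))"
    using bailey_coeff_raise[OF p, of n "Suc 0"] by simp
  also have "(1 - p ^ (n + 2)) * bailey_coeff p (Suc n) (Suc 0) = (1 - p ^ Suc n) * U"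
    using bailey_coeff_shift[OF p, of "Suc n" 0] by (simp add: U_def)
  finally have B1: "bailey_coeff p n (Suc 0) = (1 - p ^ n) * ((1 - p ^ Suc n) * U)" .
  have B0: "bailey_coeff p n 0 = (1 - p ^ Suc n) * (1 - p ^ Suc n) * U"
    using bailey_coeff_raise[OF p, of n 0] by (simp add: U_def)
  define u where "u = p ^ n"
  have e: "p ^ (2 * n + 1) = u ^ 2 * p" "p ^ (2 * n + 2) = u ^ 2 * p ^ 2" "p ^ n = u" "p ^ Suc n = u * p"
    unfolding u_def by (simp_all add: eval_nat_numeral power_add mult_ac mult_2)
  show ?thesis
    unfolding B0 B1 U_def[symmetric] e by algebra
qed

text \<open>As xy = p, the product (1 - x p^n)(1 - y p^n) equals 1 + p^{2n+1} - (x + y) p^n. Its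
  part 1 + p^{2n+1} cancels against the index recurrence, and the rest telescopes in each half of
  \<open>theta_coeff\<close>, leaving \<open>P x J\<close> and \<open>P y J\<close>.\<close>

lemma triple_product_partial_sum:
  fixes n :: nat
  assumes p: "norm p < 1" and xy: "p = x * y"
  defines "P \<equiv> \<lambda>z J. altprod z p (Suc J) * p ^ (n - J) * bailey_coeff p n J
    - altprod z p J * p ^ (n + J + 1) * bailey_coeff p n (Suc J)"
  shows "(\<Sum>j\<le>J. theta_coeff x y j *
      ((1 - x * p ^ n) * (1 - y * p ^ n) * bailey_coeff p n j
        - (1 - p ^ (2 * n + 1)) * (1 - p ^ (2 * n + 2)) * bailey_coeff p (Suc n) j)) = P x J + P y J"
proof (induction J)
  case 0
  have "p ^ (2 * n + 1) = x * y * p ^ n * p ^ n"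
    by (simp add: xy mult_2 power_add)
  then show ?case
    using bailey_coeff_index_recurrence_0[OF p, of n]
    by (simp add: theta_coeff_def P_def algebra_simps)
next
  case (Suc J)
  define B0 B1 B2 where "B0 = bailey_coeff p n J" "B1 = bailey_coeff p n (Suc J)" "B2 = bailey_coeff p n (Suc (Suc J))"
  define s t a r X Y where "s = p ^ J" "t = p ^ n" "a = p ^ (n - J)" "r = p ^ (n - Suc J)"
    "X = altprod x p J" "Y = altprod y p J"
  note defs = this B0_B1_B2_def
  \<comment> \<open>Without \<open>B1\<close> this can fail for J >= n, where
    \<open>n - Suc J\<close> truncates; there \<open>B1\<close> is zero.\<close>
  have key: "p * s * r * B1 = t * B1"
  proof (cases "Suc J \<le> n")
    case True
    then have "p * s * r = t"
      unfolding defs by (simp flip: power_add power_Suc)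
    then show ?thesis by simp
  qed (simp add: defs bailey_coeff_zero)
  have e: "p ^ (2 * n + 1) = p * t * t" "p ^ (n + J + 1) = p * t * s"
    "p ^ (n + Suc J + 1) = p * p * t * s" "p ^ (n + J + 2) = p * p * t * s" "p ^ Suc J = p * s"
    unfolding defs by (simp_all add: mult_2 power_add power2_eq_square)
  have coeff: "theta_coeff x y (Suc J) = X * (- x * s) + Y * (- y * s)"
    by (simp add: theta_coeff_def xy defs)
  show ?case
    unfolding sum.atMost_Suc Suc.IH
    unfolding bailey_coeff_index_recurrence[OF p] P_def
    unfolding coeff altprod_Suc e defs[symmetric]
    using key xy by algebra
qed

text \<open>Up to the factor (p)_{2n} this is the q-binomial theorem centred at the middle of row
  2n.\<close>

lemma finite_triple_product:
  assumes p: "norm p < 1" and xy: "p = x * y"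
  shows "(\<Sum>j\<le>n. theta_coeff x y j * bailey_coeff p n j) =
    qpoch x p n * qpoch y p n / qpoch p p (2 * n)"
proof (induction n)
  case 0
  show ?case by (simp add: theta_coeff_def bailey_coeff_def)
next
  case (Suc n)
  let ?S = "\<lambda>n. \<Sum>j\<le>n. theta_coeff x y j * bailey_coeff p n j"
  define a b where "a = (1 - x * p ^ n) * (1 - y * p ^ n)" "b = (1 - p ^ (2 * n + 1)) * (1 - p ^ (2 * n + 2))"
  have b: "b \<noteq> 0"
    using one_minus_power_nonzero[OF p, of "2 * n + 1"] one_minus_power_nonzero[OF p, of "2 * n + 2"]
    by (simp add: a_b_def)
  have "(\<Sum>j\<le>Suc n. theta_coeff x y j * (a * bailey_coeff p n j - b * bailey_coeff p (Suc n) j)) = 0"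
    unfolding a_b_def triple_product_partial_sum[OF p xy, of n "Suc n"]
    by (simp add: bailey_coeff_zero)
  then have "a * (\<Sum>j\<le>Suc n. theta_coeff x y j * bailey_coeff p n j) = b * ?S (Suc n)"
    unfolding sum_distrib_left
    by (simp only: right_diff_distrib sum_subtractf mult.left_commute right_minus_eq)
  then have "a * ?S n = b * ?S (Suc n)"
    by (simp add: bailey_coeff_zero)
  then have "?S (Suc n) = a * ?S n / b"
    using b by (simp add: nonzero_eq_divide_eq mult.commute)
  also have "\<dots> = qpoch x p (Suc n) * qpoch y p (Suc n) / qpoch p p (2 * Suc n)"
    unfolding Suc.IH by (simp add: qpoch_Suc a_b_def mult_ac)
  finally show ?case .
qed

lemma bailey_coeff_tendsto:
  assumes p: "norm p < 1"
  shows "(\<lambda>n. bailey_coeff p n j) \<longlonglongrightarrow> 1 / (qpoch_inf p p * qpoch_inf p p)"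
proof (rule Lim_transform_eventually)
  have "(\<lambda>n. qpoch p p (n + j)) \<longlonglongrightarrow> qpoch_inf p p"
    by (intro LIMSEQ_ignore_initial_segment qpoch_tendsto p)
  moreover have "(\<lambda>n. qpoch p p (n - j)) \<longlonglongrightarrow> qpoch_inf p p"
    by (rule LIMSEQ_offset[where k = j]) (simp add: qpoch_tendsto p)
  ultimately show "(\<lambda>n. 1 / (qpoch p p (n + j) * qpoch p p (n - j))) \<longlonglongrightarrow> 1 / (qpoch_inf p p * qpoch_inf p p)"
    by (intro tendsto_intros) (auto simp: qpoch_inf_nonzero p)
  show "eventually (\<lambda>n. 1 / (qpoch p p (n + j) * qpoch p p (n - j)) = bailey_coeff p n j) sequentially"
    using eventually_ge_at_top[of j] by eventually_elim (simp add: bailey_coeff_def)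
qed

text \<open>The limit of the finite form: each weight tends to 1 / (p)_infinity^2 and the right-hand
  side keeps one 1 / (p)_infinity, so one factor (p)_infinity survives. Tannery's theorem permits
  the limit under the sum.\<close>

lemma jacobi_triple_product:
  assumes "norm x < 1" "norm y < 1"
  shows "(\<Sum>j. theta_coeff x y j) =
    qpoch_inf (x * y) (x * y) * qpoch_inf x (x * y) * qpoch_inf y (x * y)"
proof -
  define p where "p = x * y"
  have p: "norm p < 1"
    using assms mult_strict_mono[of "norm x" 1 "norm y" 1] by (simp add: p_def norm_mult)
  define P where "P = qpoch_inf p p"
  have P: "P \<noteq> 0" using qpoch_inf_nonzero[OF p] by (simp add: P_def)
  obtain C where C: "C > 0" "\<And>n j. norm (bailey_coeff p n j) \<le> C"
    using bailey_coeff_bounded[OF p] by blast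
  have "(\<lambda>n. \<Sum>j. theta_coeff x y j * bailey_coeff p n j) \<longlonglongrightarrow>
      (\<Sum>j. theta_coeff x y j * (1 / (P * P)))"
  proof (rule tannerys_theorem[THEN conjunct2, THEN conjunct2])
    show "(\<lambda>n. theta_coeff x y j * bailey_coeff p n j) \<longlonglongrightarrow> theta_coeff x y j * (1 / (P * P))" for j
      unfolding P_def by (intro tendsto_intros bailey_coeff_tendsto p)
    show "summable (\<lambda>j. norm (theta_coeff x y j) * C)"
      by (intro summable_mult2 theta_coeff_summable assms)
    show "\<forall>\<^sub>F (j, n) in sequentially \<times>\<^sub>F sequentially.
        norm (theta_coeff x y j * bailey_coeff p n j) \<le> norm (theta_coeff x y j) * C"
      by (intro always_eventually) (auto simp: norm_mult intro!: mult_left_mono C)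
  qed simp
  moreover have "(\<Sum>j. theta_coeff x y j * bailey_coeff p n j) =
      qpoch x p n * qpoch y p n / qpoch p p (2 * n)" for n
  proof -
    have "(\<Sum>j. theta_coeff x y j * bailey_coeff p n j) = (\<Sum>j\<le>n. theta_coeff x y j * bailey_coeff p n j)"
      by (rule suminf_finite) (auto simp: bailey_coeff_zero)
    then show ?thesis using finite_triple_product[OF p p_def] by simp
  qed
  moreover have "(\<lambda>n. qpoch x p n * qpoch y p n / qpoch p p (2 * n)) \<longlonglongrightarrow> qpoch_inf x p * qpoch_inf y p / P"
  proof -
    have "(\<lambda>n. qpoch p p (2 * n)) \<longlonglongrightarrow> P"
      using LIMSEQ_subseq_LIMSEQ[OF qpoch_tendsto[OF p], of "\<lambda>n. 2 * n"]
      by (simp add: strict_mono_def o_def P_def)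
    then show ?thesis
      using P by (intro tendsto_intros qpoch_tendsto p)
  qed
  ultimately have "(\<Sum>j. theta_coeff x y j * (1 / (P * P))) = qpoch_inf x p * qpoch_inf y p / P"
    using LIMSEQ_unique by simp
  also have "(\<Sum>j. theta_coeff x y j * (1 / (P * P))) = (\<Sum>j. theta_coeff x y j) * (1 / (P * P))"
    by (rule suminf_mult2[symmetric]) (rule summable_norm_cancel[OF theta_coeff_summable[OF assms]])
  finally have lim: "(\<Sum>j. theta_coeff x y j) * (1 / (P * P)) = qpoch_inf x p * qpoch_inf y p / P" .
  have cancel: "S = P * A * B" if "S * (1 / (P * P)) = A * B / P" for S A B
    using that P by (simp add: field_simps)
  show ?thesis
    using cancel[OF lim] unfolding P_def p_def .
qed

subsection \<open>The triple sum\<close>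

lemma cong_mod_9_iff:
  fixes m :: nat
  shows "[int m = 0] (mod 9) \<longleftrightarrow> m mod 9 = 0"
    and "[int m = 4] (mod 9) \<longleftrightarrow> m mod 9 = 4"
    and "[int m = -4] (mod 9) \<longleftrightarrow> m mod 9 = 5"
proof -
  define r where "r = m mod 9"
  have "int m mod 9 = int r" by (simp add: r_def zmod_int)
  then show "[int m = 0] (mod 9) \<longleftrightarrow> m mod 9 = 0"
    and "[int m = 4] (mod 9) \<longleftrightarrow> m mod 9 = 4"
    and "[int m = -4] (mod 9) \<longleftrightarrow> m mod 9 = 5"
    unfolding cong_def r_def[symmetric] by simp_all
qed

text \<open>Nine factors at a time, the residues 1, 2, 3, 6, 7, 8 cancel against those of (q)_{9M};
  the residues 4, 5 and 9 remain and build the products in base q^9.\<close>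

lemma mod_9_product:
  fixes q :: complex
  assumes q: "norm q < 1"
  defines "f \<equiv> \<lambda>m::nat. if m \<ge> 1 \<and> \<not> [int m = 0] (mod 9) \<and>
      \<not> [int m = 4] (mod 9) \<and> \<not> [int m = -4] (mod 9) then 1 / (1 - q ^ m) else 1"
  shows "(\<Prod>m. f m) * qpoch_inf q q =
    qpoch_inf (q ^ 9) (q ^ 9) * qpoch_inf (q ^ 5) (q ^ 9) * qpoch_inf (q ^ 4) (q ^ 9)"
proof -
  have q9: "norm (q ^ 9) < 1"
    using q by (simp add: norm_power power_less_one_iff)
  have f: "f m = (if m mod 9 \<in> {0, 4, 5} then 1 else 1 / (1 - q ^ m))" for m
  proof -
    have "m \<ge> 1" if "m mod 9 \<noteq> 0"
      using that by (cases m) auto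
    then show ?thesis
      unfolding f_def cong_mod_9_iff by (metis insert_iff empty_iff)
  qed
  have conv: "convergent_prod f"
  proof -
    define g where "g m = (if m mod 9 \<in> {0, 4, 5} then 1 else 1 - q ^ m)" for m :: nat
    have "summable (\<lambda>m. norm (g m - 1))"
    proof (rule summable_comparison_test'[where N = 0])
      show "summable (\<lambda>m. norm q ^ m)" using q by (simp add: summable_geometric)
      show "norm (norm (g m - 1)) \<le> norm q ^ m" for m
        by (simp add: g_def norm_power)
    qed
    then have "convergent_prod g"
      by (intro abs_convergent_prod_imp_convergent_prod) (simp add: abs_convergent_prod_conv_summable)
    then have "convergent_prod (\<lambda>m. inverse (g m))"
      by (rule convergent_prod_inverse)
    moreover have "(\<lambda>m. inverse (g m)) = f"
      by (auto simp: f g_def divide_inverse)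
    ultimately show ?thesis by simp
  qed
  have partial: "(\<Prod>m<9 * M. f m) * qpoch q q (9 * M) =
      qpoch (q ^ 9) (q ^ 9) M * qpoch (q ^ 5) (q ^ 9) M * qpoch (q ^ 4) (q ^ 9) M" for M
  proof (induction M)
    case (Suc M)
    define N where "N = 9 * M"
    \<comment> \<open>The block of \<open>f\<close> has the exponents N to N + 8, that of
      \<open>qpoch\<close> N + 1 to N + 9; the offset is harmless since \<open>f\<close> is 1 at
      multiples of 9.\<close>
    define h where "h i = 1 - q ^ (N + i)" for i
    have h: "h i \<noteq> 0" if "i > 0" for i
      unfolding h_def using that by (intro one_minus_power_nonzero[OF q]) simp
    have nine: "9 * Suc M = Suc (Suc (Suc (Suc (Suc (Suc (Suc (Suc (Suc N))))))))"
      by (simp add: N_def)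
    have "(\<Prod>m<9 * Suc M. f m) = (\<Prod>m<N. f m) * (f N * f (N + 1) * f (N + 2) *
        f (N + 3) * f (N + 4) * f (N + 5) * f (N + 6) * f (N + 7) * f (N + 8))"
      unfolding nine prod.lessThan_Suc by (simp only: eval_nat_numeral BitM.simps add_Suc_right add_0_right One_nat_def mult.assoc)
    also have "f N * f (N + 1) * f (N + 2) *
        f (N + 3) * f (N + 4) * f (N + 5) * f (N + 6) * f (N + 7) * f (N + 8) =
        1 / (h 1 * h 2 * h 3 * h 6 * h 7 * h 8)"
    proof -
      have "f (N + i) = (if i \<in> {0, 4, 5} then 1 else 1 / h i)" if "i < 9" for i
        using that by (simp add: f h_def N_def)
      from this[of 0] this[of 1] this[of 2] this[of 3] this[of 4] this[of 5] this[of 6] this[of 7]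
        this[of 8]
      show ?thesis by simp
    qed
    finally have fs: "(\<Prod>m<9 * Suc M. f m) = (\<Prod>m<N. f m) * (1 / (h 1 * h 2 * h 3 * h 6 * h 7 * h 8))" .
    have qs: "qpoch q q (9 * Suc M) =
        qpoch q q N * (h 1 * h 2 * h 3 * h 4 * h 5 * h 6 * h 7 * h 8 * h 9)"
      unfolding nine qpoch_Suc h_def
      by (simp only: eval_nat_numeral BitM.simps add_Suc_right add_0_right One_nat_def mult.assoc power_Suc)
    have ps: "qpoch (q ^ i) (q ^ 9) (Suc M) = qpoch (q ^ i) (q ^ 9) M * h i" for i
      unfolding qpoch_Suc h_def N_def power_add power_mult by (simp only: mult.commute)
    have "(\<Prod>m<9 * Suc M. f m) * qpoch q q (9 * Suc M) =
        (\<Prod>m<N. f m) * qpoch q q N * (h 9 * h 5 * h 4)"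
      unfolding fs qs using h by simp
    then show ?case
      unfolding N_def Suc.IH ps by (simp only: mult_ac)
  qed simp
  have mono: "strict_mono (\<lambda>M::nat. 9 * M)" by (simp add: strict_mono_def)
  have "(\<lambda>M. (\<Prod>m<9 * M. f m) * qpoch q q (9 * M)) \<longlonglongrightarrow> (\<Prod>m. f m) * qpoch_inf q q"
    using LIMSEQ_subseq_LIMSEQ[OF has_prod_imp_tendsto'[OF convergent_prod_has_prod[OF conv]] mono]
      LIMSEQ_subseq_LIMSEQ[OF qpoch_tendsto[OF q] mono]
    by (intro tendsto_mult) (simp_all add: o_def)
  moreover have "(\<lambda>M. (\<Prod>m<9 * M. f m) * qpoch q q (9 * M)) \<longlonglongrightarrow>
      qpoch_inf (q ^ 9) (q ^ 9) * qpoch_inf (q ^ 5) (q ^ 9) * qpoch_inf (q ^ 4) (q ^ 9)"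
    unfolding partial by (intro tendsto_mult qpoch_tendsto q9)
  ultimately show ?thesis by (rule LIMSEQ_unique)
qed

lemma summable_on_product_nonneg:
  fixes f :: "'a \<Rightarrow> real" and g :: "'b \<Rightarrow> real"
  assumes "f summable_on A" "g summable_on B" "\<And>x. f x \<ge> 0" "\<And>y. g y \<ge> 0"
  shows "(\<lambda>(x, y). f x * g y) summable_on A \<times> B"
proof (rule summable_on_SigmaI)
  show "((\<lambda>y. case (x, y) of (x, y) \<Rightarrow> f x * g y) has_sum f x * infsum g B) B" for x
    using assms(2) by (simp add: has_sum_cmult_right)
  show "(\<lambda>x. f x * infsum g B) summable_on A"
    using assms(1) by (rule summable_on_cmult_left)
qed (use assms in auto)

lemma has_sum_product_complex:
  fixes f :: "'a \<Rightarrow> complex" and g :: "'b \<Rightarrow> complex"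
  assumes f: "(f has_sum a) A" and g: "(g has_sum b) B"
  shows "((\<lambda>(x, y). f x * g y) has_sum a * b) (A \<times> B)"
proof (rule has_sum_SigmaI)
  show "((\<lambda>y. case (x, y) of (x, y) \<Rightarrow> f x * g y) has_sum f x * b) B" for x
    using g by (simp add: has_sum_cmult_right)
  show "((\<lambda>x. f x * b) has_sum a * b) A"
    using f by (rule has_sum_cmult_left)
  have "(\<lambda>(x, y). norm (f x) * norm (g y)) summable_on A \<times> B"
    using has_sum_imp_summable[OF f] has_sum_imp_summable[OF g]
    by (intro summable_on_product_nonneg) (simp_all add: summable_on_iff_abs_summable_on_complex)
  then have "(\<lambda>z. norm (case z of (x, y) \<Rightarrow> f x * g y)) summable_on A \<times> B"
    by (simp add: case_prod_unfold norm_mult)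
  then show "(\<lambda>(x, y). f x * g y) summable_on A \<times> B"
    by (rule abs_summable_summable)
qed

text \<open>Since j^2 = j + 2 * j(j-1)/2, the power r^{j^2} gives r to z and r^2 to p. With r = q^3
  it carries the Dixon parameters q^2, q to q^5, q^4.\<close>

lemma altprod_mult_power_square:
  "altprod z p j * r ^ j\<^sup>2 = altprod (z * r) (p * r\<^sup>2) j"
proof (induction j)
  case (Suc j)
  have "altprod z p (Suc j) * r ^ (Suc j)\<^sup>2 = (altprod z p j * r ^ j\<^sup>2) * (- (z * r) * (p * r\<^sup>2) ^ j)"
    by (simp add: power2_eq_square power_add power_mult_distrib mult_ac)
  then show ?case by (simp only: Suc altprod_Suc)
qed simp

theorem mainTheorem13:
  fixes q :: complex
  assumes "norm q < 1"
  shows "((\<lambda>(n::nat, l::nat, k::nat).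
            q ^ (n\<^sup>2 + l\<^sup>2 + k\<^sup>2) * qpoch q q (n + l + k) /
            (qpoch q q (n + l) * qpoch q q (n + k) * qpoch q q (l + k) *
             qpoch q q n * qpoch q q l * qpoch q q k))
          has_sum
          (1 / (qpoch_inf q q)\<^sup>2 *
           (\<Prod>m::nat. if m \<ge> 1 \<and> \<not> [int m = 0] (mod 9) \<and>
                          \<not> [int m = 4] (mod 9) \<and> \<not> [int m = -4] (mod 9)
                       then 1 / (1 - q ^ m) else 1))) UNIV"
proof -
  define Q where "Q = qpoch_inf q q"
  have Q: "Q \<noteq> 0" using qpoch_inf_nonzero[OF assms] by (simp add: Q_def)
  define a where "a j n = q ^ n\<^sup>2 * bailey_coeff q n j" for j n
  define w where "w = theta_coeff (q\<^sup>2) q"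
  \<comment> \<open>Summed over n, l, k first, this family gives the theta series; summed over j
    first, it gives the Dixon quotients.\<close>
  define \<Phi> where "\<Phi> = (\<lambda>(j, n, l, k). w j * (a j n * (a j l * a j k)))"
  obtain C where C: "C > 0" "\<And>n j. norm (bailey_coeff q n j) \<le> C"
    using bailey_coeff_bounded[OF assms] by blast
  \<comment> \<open>A bound for \<open>a j n\<close> free of j, so that the majorant of
    \<open>\<Phi>\<close> factors into four single series.\<close>
  define b where "b n = C * norm q ^ n\<^sup>2" for n :: nat
  have b: "b summable_on UNIV" "b n \<ge> 0" for n
    using summable_on_cmult_right[OF summable_on_power_square[of "norm q"], of C] assms C(1)
    by (simp_all add: b_def[abs_def])
  have ab: "norm (a j n) \<le> b n" for j n
    using C mult_right_mono[OF C(2), of "norm q ^ n\<^sup>2" n j]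
    by (simp add: a_def b_def norm_mult norm_power mult.commute)
  have norm_pow: "norm (q ^ i) < 1" if "i > 0" for i
    using assms that by (simp add: norm_power power_less_one_iff)
  have w: "(\<lambda>j. norm (w j)) summable_on UNIV"
    using theta_coeff_summable[of "q\<^sup>2" q] assms norm_pow[of 2]
    by (intro summable_nonneg_imp_summable_on) (simp_all add: w_def)
  have "(\<lambda>(j, n, l, k). norm (w j) * (b n * (b l * b k))) summable_on UNIV \<times> UNIV \<times> UNIV \<times> UNIV"
    using summable_on_product_nonneg[OF w summable_on_product_nonneg[OF b(1) summable_on_product_nonneg[OF b(1) b(1)]]] b(2)
    by (simp add: case_prod_unfold)
  then have "(\<lambda>z. norm (\<Phi> z)) summable_on UNIV \<times> UNIV \<times> UNIV \<times> UNIV"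
    by (rule summable_on_comparison_test)
      (auto simp: \<Phi>_def norm_mult intro!: mult_left_mono mult_mono ab b)
  then have \<Phi>_summable: "\<Phi> summable_on UNIV \<times> UNIV"
    by (simp add: abs_summable_summable)
  have a: "(a j has_sum q ^ j\<^sup>2 / Q) UNIV" for j
    using bailey_coeff_has_sum[OF assms, of j] by (simp add: a_def[abs_def] Q_def)
  have inner: "((\<lambda>z. \<Phi> (j, z)) has_sum theta_coeff (q ^ 5) (q ^ 4) j * (1 / Q ^ 3)) UNIV" for j
  proof -
    have "((\<lambda>z. \<Phi> (j, z)) has_sum w j * (q ^ j\<^sup>2 / Q * (q ^ j\<^sup>2 / Q * (q ^ j\<^sup>2 / Q)))) (UNIV \<times> UNIV \<times> UNIV)"
      using has_sum_cmult_right[OF has_sum_product_complex[OF a has_sum_product_complex[OF a a]], of "w j" j j j]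
      by (simp add: \<Phi>_def case_prod_unfold)
    moreover have "w j * (q ^ 3) ^ j\<^sup>2 = theta_coeff (q ^ 5) (q ^ 4) j"
    proof -
      have "q\<^sup>2 * q ^ 3 = q ^ 5" "q ^ 3 * (q ^ 3)\<^sup>2 = q ^ 9" "q * q ^ 3 = q ^ 4" "q\<^sup>2 * q = q ^ 3"
        "q ^ 5 * q ^ 4 = q ^ 9"
        by (simp_all add: eval_nat_numeral mult_ac)
      then show ?thesis
        by (simp add: w_def theta_coeff_def distrib_right altprod_mult_power_square)
    qed
    moreover have "(q ^ 3) ^ j\<^sup>2 = q ^ j\<^sup>2 * q ^ j\<^sup>2 * q ^ j\<^sup>2"
      by (simp add: power3_eq_cube power_mult_distrib)
    ultimately show ?thesis by (simp add: power3_eq_cube mult.assoc)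
  qed
  define T where "T = (\<Sum>j. theta_coeff (q ^ 5) (q ^ 4) j)"
  have "summable (\<lambda>j. norm (theta_coeff (q ^ 5) (q ^ 4) j))"
    by (intro theta_coeff_summable norm_pow) simp_all
  then have "(theta_coeff (q ^ 5) (q ^ 4) has_sum T) UNIV"
    using summable_norm_cancel unfolding T_def
    by (blast intro: norm_summable_imp_has_sum summable_sums)
  then have "((\<lambda>j. theta_coeff (q ^ 5) (q ^ 4) j * (1 / Q ^ 3)) has_sum T * (1 / Q ^ 3)) UNIV"
    by (rule has_sum_cmult_left)
  then have "(\<Phi> has_sum T * (1 / Q ^ 3)) (UNIV \<times> UNIV)"
    using inner \<Phi>_summable by (intro has_sum_SigmaI) auto
  then have "((\<lambda>(z, j). \<Phi> (j, z)) has_sum T * (1 / Q ^ 3)) (UNIV \<times> UNIV)"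
    by (subst (asm) has_sum_swap)
  moreover have "((\<lambda>j. case (z, j) of (z, j) \<Rightarrow> \<Phi> (j, z)) has_sum (case z of (n, l, k) \<Rightarrow>
      q ^ (n\<^sup>2 + l\<^sup>2 + k\<^sup>2) * qpoch q q (n + l + k) /
        (qpoch q q (n + l) * qpoch q q (n + k) * qpoch q q (l + k) *
         qpoch q q n * qpoch q q l * qpoch q q k))) UNIV" for z
  proof -
    obtain n l k where z: "z = (n, l, k)" by (cases z)
    have "(\<Sum>j\<le>l. \<Phi> (j, n, l, k)) = q ^ (n\<^sup>2 + l\<^sup>2 + k\<^sup>2) * (\<Sum>j\<le>l. w j *
        bailey_coeff q n j * bailey_coeff q l j * bailey_coeff q k j)"
      unfolding sum_distrib_left by (simp add: \<Phi>_def a_def power_add mult_ac)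
    also have "\<dots> = q ^ (n\<^sup>2 + l\<^sup>2 + k\<^sup>2) * qpoch q q (n + l + k) /
            (qpoch q q (n + l) * qpoch q q (n + k) * qpoch q q (l + k) *
             qpoch q q n * qpoch q q l * qpoch q q k)"
      unfolding w_def q_dixon[OF assms] by simp
    finally show ?thesis
      unfolding z by (intro has_sum_finite_neutralI[of "{..l}"]) (auto simp: \<Phi>_def a_def bailey_coeff_zero)
  qed
  ultimately have "((\<lambda>(n, l, k).
            q ^ (n\<^sup>2 + l\<^sup>2 + k\<^sup>2) * qpoch q q (n + l + k) /
            (qpoch q q (n + l) * qpoch q q (n + k) * qpoch q q (l + k) *
             qpoch q q n * qpoch q q l * qpoch q q k)) has_sum T * (1 / Q ^ 3)) UNIV"
    by (rule has_sum_SigmaD)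
  \<comment> \<open>The factor \<open>Q\<close> gained here reduces \<open>1 / Q ^ 3\<close> to the
    required inverse square.\<close>
  moreover have "T = (\<Prod>m::nat. if m \<ge> 1 \<and> \<not> [int m = 0] (mod 9) \<and>
                          \<not> [int m = 4] (mod 9) \<and> \<not> [int m = -4] (mod 9)
                       then 1 / (1 - q ^ m) else 1) * Q"
    using jacobi_triple_product[of "q ^ 5" "q ^ 4"] norm_pow
    unfolding T_def Q_def mod_9_product[OF assms] by (simp flip: power_add)
  ultimately show ?thesis
    using Q by (simp add: Q_def power2_eq_square power3_eq_cube)
qed

end
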